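(* There is a $\sqsubseteq$-antichain of cardinality $\mathfrak{c}$ consisting of Erdős–Ulam ideals which are not simple density ideals.
   Context: $\omega=\{0,1,2,\ldots\}$ and $n\in\omega$ is identified with $\{0,\ldots,n-1\}$; $\mathfrak{c}$ is the cardinality of the continuum. An ideal on $\omega$ is a family of subsets of $\omega$ closed under finite unions and subsets, which is a proper subset of the power set of $\omega$ and contains all finite subsets of $\omega$. A simple density ideal is an ideal of the form $\mathcal{Z}_g=\{A\subseteq\omega:\lim_{n\to\infty}\frac{\mathrm{card}(A\cap n)}{g(n)}=0\}$, where $g\colon\omega\to[0,\infty)$ satisfies $\lim_{n\to\infty}g(n)=\infty$ and $\frac{n}{g(n)}$ does not converge to $0$. An Erdős–Ulam ideal is an ideal of the form $\mathcal{EU}_f=\{A\subseteq\omega:\lim_{n\to\infty}\frac{\sum_{i\in A\cap n}f(i)}{\sum_{i=0}^{n-1}f(i)}=0\}$, where $f\colon\omega\to[0,\infty)$ satisfies $\sum_{i=0}^\infty f(i)=\infty$ and $\lim_{n\to\infty}\frac{f(n)}{\sum_{i=0}^nf(i)}=0$. $\mathcal{I}\sqsubseteq\mathcal{J}$ means that there is a bijection $\phi\colon\omega\to\omega$ such that $A\in\mathcal{I}$ implies $\phi^{-1}[A]\in\mathcal{J}$ for all $A\subseteq\omega$. A family $\mathcal{F}$ of ideals is a $\sqsubseteq$-antichain if $\mathcal{I}\not\sqsubseteq\mathcal{J}$ and $\mathcal{J}\not\sqsubseteq\mathcal{I}$ for every pair of distinct ideals $\mathcal{I},\mathcal{J}\in\mathcal{F}$.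 *)

theory Defs
  imports Complex_Main "HOL-Library.Equipollence"
begin

definition ideal_on_nat :: "nat set set \<Rightarrow> bool" where
  "ideal_on_nat I \<longleftrightarrow>
     (\<forall>A\<in>I. \<forall>B\<in>I. A \<union> B \<in> I) \<and>
     (\<forall>A\<in>I. \<forall>B. B \<subseteq> A \<longrightarrow> B \<in> I) \<and>
     I \<noteq> UNIV \<and>
     (\<forall>A. finite A \<longrightarrow> A \<in> I)"

text \<open>
  In the quotients below the denominators vanish for at most finitely many \<open>n\<close>
  whenever the parameter function is admissible, so the convention \<open>x / 0 = 0\<close>
  does not affect the limits.
\<close>

definition density_family :: "(nat \<Rightarrow> real) \<Rightarrow> nat set set" where
  "density_family g =
     {A. (\<lambda>n. real (card (A \<inter> {..<n})) / g n) \<longlonglongrightarrow> 0}"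

definition simple_density_ideal :: "nat set set \<Rightarrow> bool" where
  "simple_density_ideal I \<longleftrightarrow>
     ideal_on_nat I \<and>
     (\<exists>g :: nat \<Rightarrow> real.
        (\<forall>n. 0 \<le> g n) \<and>
        filterlim g at_top sequentially \<and>
        \<not> (\<lambda>n. real n / g n) \<longlonglongrightarrow> 0 \<and>
        I = density_family g)"

definition erdos_ulam_family :: "(nat \<Rightarrow> real) \<Rightarrow> nat set set" where
  "erdos_ulam_family f =
     {A. (\<lambda>n. (\<Sum>i\<in>A \<inter> {..<n}. f i) / (\<Sum>i<n. f i)) \<longlonglongrightarrow> 0}"

definition erdos_ulam_ideal :: "nat set set \<Rightarrow> bool" where
  "erdos_ulam_ideal I \<longleftrightarrow>
     ideal_on_nat I \<and>
     (\<exists>f :: nat \<Rightarrow> real.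
        (\<forall>n. 0 \<le> f n) \<and>
        filterlim (\<lambda>n. \<Sum>i<n. f i) at_top sequentially \<and>
        (\<lambda>n. f n / (\<Sum>i\<le>n. f i)) \<longlonglongrightarrow> 0 \<and>
        I = erdos_ulam_family f)"

definition ideal_below :: "nat set set \<Rightarrow> nat set set \<Rightarrow> bool" where
  "ideal_below I J \<longleftrightarrow>
     (\<exists>\<phi> :: nat \<Rightarrow> nat. bij \<phi> \<and> (\<forall>A. A \<in> I \<longrightarrow> \<phi> -` A \<in> J))"

definition ideal_antichain :: "nat set set set \<Rightarrow> bool" where
  "ideal_antichain F \<longleftrightarrow>
     (\<forall>I\<in>F. ideal_on_nat I) \<and>
     (\<forall>I\<in>F. \<forall>J\<in>F. I \<noteq> J \<longrightarrow> \<not> ideal_below I J \<and> \<not> ideal_below J I)"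

end

theory Submission
  imports Defs "HOL-Analysis.Abstract_Topology_2"
begin

text \<open>
  Cut \<open>\<omega>\<close> into consecutive finite blocks and consider the sets whose relative density in the
  \<open>n\<close>-th block tends to \<open>0\<close>. If the block lengths tend to infinity, this is an Erdos-Ulam ideal:
  spread the mass \<open>2 ^ n\<close> uniformly over the \<open>n\<close>-th block. All ideals below are of this kind, and
  their block lengths are distinct terms of one rapidly growing sequence \<open>K\<close>, in which the sum of
  all terms before \<open>K j\<close> is at most \<open>K j / j\<close>.

  Which lengths occur is almost determined by the ideal, up to \<open>\<sqsubseteq>\<close>. Suppose that a bijection
  \<open>\<phi>\<close> witnesses that the ideal with lengths \<open>K (s m)\<close> is below the one with lengths \<open>K (t n)\<close>,
  and that the length \<open>K (t n)\<close> is not available among the \<open>K (s m)\<close>. By rapid growth, the blocks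
  shorter than \<open>K (t n)\<close> on the side of \<open>s\<close> have room for only a small proportion of the image of
  the \<open>n\<close>-th block. Almost all of the image lies in longer blocks, where, again by rapid growth,
  the images of all shorter blocks together have small density. If this happened
  for infinitely many \<open>n\<close>, these images would form a set in the first ideal whose preimage has
  density close to \<open>1\<close> in infinitely many blocks (lemma \<open>ideal_below_rapid_ideal\<close>). So continuum
  many sets of lengths that pairwise differ by infinite sets, in both directions, give
  \<open>\<sqsubseteq>\<close>-incomparable ideals.

  The order of the blocks serves to leave the class of simple density ideals. Membership in
  \<open>\<Z>\<^sub>g\<close> depends only on the counting function \<open>card (A \<inter> n)\<close> and is inherited by sets with a
  smaller counting function. In increasing order of length the ideals would be simple density ideals, with \<open>g\<close> constant on every block and
  equal to its length. Therefore the lengths are arranged so that each block with an odd index is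
  much shorter than the block just before it: the union of the short blocks is not in the ideal,
  but copying every short block into the long block to its left gives a set that is in the ideal
  and has a larger counting function
  (lemma \<open>not_simple_density_ideal_block_density_ideal\<close>).
\<close>

section \<open>Consecutive blocks and their density ideals\<close>

definition block_start :: "(nat \<Rightarrow> nat) \<Rightarrow> nat \<Rightarrow> nat" where
  "block_start l n = (\<Sum>k<n. l k)"

definition block :: "(nat \<Rightarrow> nat) \<Rightarrow> nat \<Rightarrow> nat set" where
  "block l n = {block_start l n..<block_start l (Suc n)}"

definition block_index :: "(nat \<Rightarrow> nat) \<Rightarrow> nat \<Rightarrow> nat" where
  "block_index l i = (LEAST n. i < block_start l (Suc n))"

definition block_density_ideal :: "(nat \<Rightarrow> nat) \<Rightarrow> nat set set" where
  "block_density_ideal l = {A. (\<lambda>n. real (card (A \<inter> block l n)) / real (l n)) \<longlonglongrightarrow> 0}"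

lemma block_start_Suc: "block_start l (Suc n) = block_start l n + l n"
  by (simp add: block_start_def)

lemma card_block [simp]: "card (block l n) = l n"
  by (simp add: block_def block_start_Suc)

lemma finite_block [simp]: "finite (block l n)"
  by (simp add: block_def)

lemma strict_mono_block_start:
  assumes "\<forall>n. 0 < l n"
  shows "strict_mono (block_start l)"
  using assms by (simp add: strict_mono_Suc_iff block_start_Suc)

text \<open>
  Block starts and block indices form a Galois connection: positive lengths make the starts
  strictly increasing and hence unbounded, so that every point lies in a block.
\<close>

lemma le_block_index_iff:
  assumes "\<forall>n. 0 < l n"
  shows "n \<le> block_index l i \<longleftrightarrow> block_start l n \<le> i"
proof -
  have sm: "strict_mono (block_start l)"
    using assms by (rule strict_mono_block_start)
  have ex: "i < block_start l (Suc i)"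
    using strict_mono_imp_increasing[OF sm, of "Suc i"] by simp
  have upper: "i < block_start l (Suc (block_index l i))"
    unfolding block_index_def using ex by (rule LeastI)
  show ?thesis
  proof
    assume n: "n \<le> block_index l i"
    show "block_start l n \<le> i"
    proof (cases n)
      case 0
      then show ?thesis by (simp add: block_start_def)
    next
      case (Suc m)
      then have "m < block_index l i" using n by simp
      then show ?thesis
        unfolding block_index_def Suc using not_less_Least by fastforce
    qed
  next
    assume "block_start l n \<le> i"
    then have "block_start l n < block_start l (Suc (block_index l i))"
      using upper by simp
    then show "n \<le> block_index l i"
      using sm by (simp add: strict_mono_less)
  qed
qed

lemma mem_block_iff:
  assumes "\<forall>n. 0 < l n"
  shows "i \<in> block l n \<longleftrightarrow> block_index l i = n"
  using le_block_index_iff[OF assms, of n i] le_block_index_iff[OF assms, of "Suc n" i]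
  by (auto simp: block_def)

lemma filterlim_block_index:
  assumes "\<forall>n. 0 < l n"
  shows "filterlim (block_index l) at_top sequentially"
  by (auto simp: filterlim_at_top eventually_sequentially le_block_index_iff[OF assms])

lemma sum_lessThan_block_start:
  fixes f :: "nat \<Rightarrow> real"
  shows "sum f (A \<inter> {..<block_start l n}) = (\<Sum>k<n. sum f (A \<inter> block l k))"
proof (induction n)
  case 0
  then show ?case by (simp add: block_start_def)
next
  case (Suc n)
  have "A \<inter> {..<block_start l (Suc n)} = (A \<inter> {..<block_start l n}) \<union> (A \<inter> block l n)"
    by (auto simp: block_def block_start_Suc)
  moreover have "(A \<inter> {..<block_start l n}) \<inter> (A \<inter> block l n) = {}"
    by (auto simp: block_def)
  ultimately show ?case
    using Suc by (simp add: sum.union_disjoint)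
qed

lemma ideal_on_nat_block_density_ideal:
  assumes pos: "\<forall>n. 0 < l n"
  shows "ideal_on_nat (block_density_ideal l)"
  unfolding ideal_on_nat_def
proof (intro conjI ballI allI impI)
  fix A B
  assume "A \<in> block_density_ideal l" "B \<in> block_density_ideal l"
  then have lim: "(\<lambda>n. real (card (A \<inter> block l n)) / real (l n)
      + real (card (B \<inter> block l n)) / real (l n)) \<longlonglongrightarrow> 0"
    unfolding block_density_ideal_def using tendsto_add by fastforce
  have "card ((A \<union> B) \<inter> block l n) \<le> card (A \<inter> block l n) + card (B \<inter> block l n)" for n
    by (simp add: Int_Un_distrib2 card_Un_le)
  then have "real (card ((A \<union> B) \<inter> block l n)) / real (l n)
      \<le> real (card (A \<inter> block l n)) / real (l n) + real (card (B \<inter> block l n)) / real (l n)" for n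
    by (simp add: add_divide_distrib[symmetric] divide_right_mono flip: of_nat_add)
  then show "A \<union> B \<in> block_density_ideal l"
    unfolding block_density_ideal_def
    by (auto intro!: tendsto_sandwich[OF _ _ tendsto_const lim])
next
  fix A B
  assume "A \<in> block_density_ideal l" and "B \<subseteq> A"
  then have lim: "(\<lambda>n. real (card (A \<inter> block l n)) / real (l n)) \<longlonglongrightarrow> 0"
    by (simp add: block_density_ideal_def)
  have "real (card (B \<inter> block l n)) / real (l n) \<le> real (card (A \<inter> block l n)) / real (l n)" for n
    using \<open>B \<subseteq> A\<close> by (intro divide_right_mono of_nat_mono card_mono) auto
  then show "B \<in> block_density_ideal l"
    unfolding block_density_ideal_def
    by (auto intro!: tendsto_sandwich[OF _ _ tendsto_const lim])
next
  have "UNIV \<notin> block_density_ideal l"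
    using pos by (simp add: block_density_ideal_def less_imp_neq[symmetric] LIMSEQ_const_iff)
  then show "block_density_ideal l \<noteq> UNIV" by auto
next
  fix A :: "nat set"
  assume "finite A"
  then obtain N where "A \<subseteq> {..<N}"
    using finite_nat_bounded by blast
  have "\<forall>\<^sub>F n in sequentially. real (card (A \<inter> block l n)) / real (l n) = 0"
    unfolding eventually_sequentially
  proof (intro exI allI impI)
    fix n assume "N \<le> n"
    also have "n \<le> block_start l n"
      using strict_mono_imp_increasing[OF strict_mono_block_start[OF pos]] by blast
    finally have "A \<inter> block l n = {}"
      using \<open>A \<subseteq> {..<N}\<close> by (auto simp: block_def)
    then show "real (card (A \<inter> block l n)) / real (l n) = 0" by simp
  qed
  then show "A \<in> block_density_ideal l"
    unfolding block_density_ideal_def by (simp add: tendsto_eventually)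
qed

section \<open>Block density ideals are Erdos-Ulam ideals\<close>

text \<open>
  The weights up to \<open>n\<close> sum to less than \<open>2 * 2 ^ n\<close>, while the weights below a fixed index
  become negligible against \<open>2 ^ n\<close>.
\<close>

lemma geometrically_weighted_mean_tendsto_0:
  fixes d :: "nat \<Rightarrow> real"
  assumes "d \<longlonglongrightarrow> 0"
  shows "(\<lambda>n. (\<Sum>k\<le>n. 2 ^ k * d k) / 2 ^ n) \<longlonglongrightarrow> 0"
proof (rule LIMSEQ_I)
  fix r :: real assume "0 < r"
  then obtain N where N: "\<And>k. k \<ge> N \<Longrightarrow> \<bar>d k\<bar> < r / 4"
    using LIMSEQ_D[OF assms, of "r / 4"] by auto
  define C where "C = (\<Sum>k<N. 2 ^ k * \<bar>d k\<bar>)"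
  have "(\<lambda>n. C / 2 ^ n) \<longlonglongrightarrow> 0"
    using LIMSEQ_divide_realpow_zero[of 2 C] by simp
  then obtain M where M: "\<And>n. n \<ge> M \<Longrightarrow> C / 2 ^ n < r / 2"
    using \<open>0 < r\<close> order_tendstoD(2)[of "\<lambda>n. C / 2 ^ n" 0 sequentially "r / 2"]
    unfolding eventually_sequentially by (metis half_gt_zero)
  show "\<exists>n0. \<forall>n\<ge>n0. norm ((\<Sum>k\<le>n. 2 ^ k * d k) / 2 ^ n - 0) < r"
  proof (intro exI allI impI)
    fix n assume n: "max N M \<le> n"
    have "\<bar>\<Sum>k\<le>n. 2 ^ k * d k\<bar> \<le> (\<Sum>k\<le>n. 2 ^ k * \<bar>d k\<bar>)"
      by (rule order_trans[OF sum_abs]) (simp add: abs_mult)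
    also have "\<dots> = C + (\<Sum>k=N..n. 2 ^ k * \<bar>d k\<bar>)"
      unfolding C_def using n
      by (subst sum.union_disjoint[symmetric]) (auto intro!: sum.cong)
    also have "(\<Sum>k=N..n. 2 ^ k * \<bar>d k\<bar>) \<le> (\<Sum>k=N..n. 2 ^ k * (r / 4))"
      using N by (intro sum_mono) (auto intro!: mult_left_mono less_imp_le)
    also have "\<dots> \<le> (\<Sum>k<Suc n. 2 ^ k * (r / 4))"
      using \<open>0 < r\<close> by (intro sum_mono2) auto
    also have "\<dots> = (2 ^ Suc n - 1) * (r / 4)"
      by (simp only: sum_distrib_right[symmetric]) (simp add: geometric_sum)
    also have "\<dots> \<le> 2 ^ n * (r / 2)"
      using \<open>0 < r\<close> by (simp add: algebra_simps)
    finally have "\<bar>\<Sum>k\<le>n. 2 ^ k * d k\<bar> / 2 ^ n \<le> (C + 2 ^ n * (r / 2)) / 2 ^ n"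
      by (simp add: divide_right_mono)
    also have "\<dots> = C / 2 ^ n + r / 2"
      by (simp add: add_divide_distrib)
    also have "\<dots> < r" using M[of n] n by linarith
    finally show "norm ((\<Sum>k\<le>n. 2 ^ k * d k) / 2 ^ n - 0) < r" by simp
  qed
qed

text \<open>
  The mass \<open>2 ^ n\<close> spread uniformly over block \<open>n\<close>: each block carries at least half of the total
  mass up to its end, so its own density governs the Erdos-Ulam quotient there.
\<close>

definition block_weight :: "(nat \<Rightarrow> nat) \<Rightarrow> nat \<Rightarrow> real" where
  "block_weight l i = 2 ^ block_index l i / real (l (block_index l i))"

lemma block_weight_nonneg: "0 \<le> block_weight l i"
  by (simp add: block_weight_def)

lemma sum_block_weight:
  assumes pos: "\<forall>n. 0 < l n"
  shows "sum (block_weight l) (A \<inter> block l n) = 2 ^ n * (real (card (A \<inter> block l n)) / real (l n))"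
proof -
  have "sum (block_weight l) (A \<inter> block l n) = (\<Sum>i\<in>A \<inter> block l n. 2 ^ n / real (l n))"
    by (rule sum.cong) (auto simp: block_weight_def mem_block_iff[OF pos])
  then show ?thesis by simp
qed

lemma sum_block_weight_start:
  assumes pos: "\<forall>n. 0 < l n"
  shows "(\<Sum>i<block_start l n. block_weight l i) = 2 ^ n - 1"
proof -
  have "(\<Sum>i<block_start l n. block_weight l i) = (\<Sum>k<n. 2 ^ k)"
    using sum_lessThan_block_start[of "block_weight l" UNIV l n]
      sum_block_weight[OF pos, where A = UNIV] pos by (simp add: less_imp_neq[symmetric])
  then show ?thesis by (simp add: geometric_sum)
qed

lemma sum_block_weight_ge:
  assumes pos: "\<forall>n. 0 < l n"
  shows "2 ^ block_index l m - 1 \<le> (\<Sum>i<m. block_weight l i)"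
proof -
  have "block_start l (block_index l m) \<le> m"
    using le_block_index_iff[OF pos] by blast
  then have "(\<Sum>i<block_start l (block_index l m). block_weight l i) \<le> (\<Sum>i<m. block_weight l i)"
    by (intro sum_mono2) (auto simp: block_weight_nonneg)
  then show ?thesis by (simp add: sum_block_weight_start[OF pos])
qed

text \<open>
  Evaluated at the end of block \<open>n\<close>, the Erdos-Ulam quotient is at least half the density in that
  block. Conversely, inside block \<open>n\<close> it is at most twice the weighted mean of the densities in
  blocks \<open>0, \<dots>, n\<close>: for \<open>n \<ge> 1\<close> the blocks before it already carry mass
  \<open>2 ^ n - 1 \<ge> 2 ^ n / 2\<close>.
\<close>

lemma erdos_ulam_family_block_weight:
  assumes pos: "\<forall>n. 0 < l n"
  shows "erdos_ulam_family (block_weight l) = block_density_ideal l"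
proof (intro set_eqI iffI)
  fix A
  let ?d = "\<lambda>n. real (card (A \<inter> block l n)) / real (l n)"
  let ?q = "\<lambda>m. (\<Sum>i\<in>A \<inter> {..<m}. block_weight l i) / (\<Sum>i<m. block_weight l i)"
  have prefix: "(\<Sum>i\<in>A \<inter> {..<block_start l n}. block_weight l i) = (\<Sum>k<n. 2 ^ k * ?d k)" for n
    by (simp add: sum_lessThan_block_start sum_block_weight[OF pos])
  {
    assume "A \<in> erdos_ulam_family (block_weight l)"
    then have "?q \<longlonglongrightarrow> 0"
      by (simp add: erdos_ulam_family_def)
    moreover have "strict_mono (\<lambda>n. block_start l (Suc n))"
      using strict_mono_block_start[OF pos] by (auto simp: strict_mono_def)
    ultimately have "(?q \<circ> (\<lambda>n. block_start l (Suc n))) \<longlonglongrightarrow> 0"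
      by (rule LIMSEQ_subseq_LIMSEQ)
    then have lim: "(\<lambda>n. 2 * ?q (block_start l (Suc n))) \<longlonglongrightarrow> 0"
      using tendsto_mult_left[of _ 0 sequentially "2::real"] by (fastforce simp: o_def)
    have "?d n \<le> 2 * ?q (block_start l (Suc n))" for n
    proof -
      have "?d n = 2 * (2 ^ n * ?d n / 2 ^ Suc n)"
        by simp
      also have "\<dots> \<le> 2 * ((\<Sum>k<Suc n. 2 ^ k * ?d k) / (2 ^ Suc n - 1))"
      proof (intro mult_left_mono frac_le)
        show "0 < (2::real) ^ Suc n - 1"
          using one_less_power[of "2::real" "Suc n"] by simp
        show "0 \<le> (\<Sum>k<Suc n. 2 ^ k * ?d k)"
          by (intro sum_nonneg) simp
        show "2 ^ n * ?d n \<le> (\<Sum>k<Suc n. 2 ^ k * ?d k)"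
          by (simp add: sum_nonneg)
      qed simp_all
      finally show ?thesis
        by (simp only: prefix sum_block_weight_start[OF pos])
    qed
    then have "?d \<longlonglongrightarrow> 0"
      by (auto intro!: tendsto_sandwich[OF _ _ tendsto_const lim])
    then show "A \<in> block_density_ideal l"
      by (simp add: block_density_ideal_def)
  }
  {
    assume "A \<in> block_density_ideal l"
    then have "?d \<longlonglongrightarrow> 0"
      by (simp add: block_density_ideal_def)
    then have "(\<lambda>n. (\<Sum>k\<le>n. 2 ^ k * ?d k) / 2 ^ n) \<longlonglongrightarrow> 0"
      by (rule geometrically_weighted_mean_tendsto_0)
    then have "(\<lambda>n. 2 * ((\<Sum>k\<le>n. 2 ^ k * ?d k) / 2 ^ n)) \<longlonglongrightarrow> 0"
      using tendsto_mult_left[of _ 0 sequentially "2::real"] by fastforce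
    then have lim: "(\<lambda>m. 2 * ((\<Sum>k\<le>block_index l m. 2 ^ k * ?d k) / 2 ^ block_index l m)) \<longlonglongrightarrow> 0"
      by (rule filterlim_compose[OF _ filterlim_block_index[OF pos]])
    have "\<forall>\<^sub>F m in sequentially. 1 \<le> block_index l m"
      using filterlim_block_index[OF pos] by (simp add: filterlim_at_top)
    then have "\<forall>\<^sub>F m in sequentially.
        ?q m \<le> 2 * ((\<Sum>k\<le>block_index l m. 2 ^ k * ?d k) / 2 ^ block_index l m)"
    proof eventually_elim
      case (elim m)
      define n where "n = block_index l m"
      have "m < block_start l (Suc n)"
        using le_block_index_iff[OF pos, of "Suc n" m] by (simp add: n_def)
      then have "(\<Sum>i\<in>A \<inter> {..<m}. block_weight l i)
          \<le> (\<Sum>i\<in>A \<inter> {..<block_start l (Suc n)}. block_weight l i)"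
        by (intro sum_mono2) (auto simp: block_weight_nonneg)
      then have num: "(\<Sum>i\<in>A \<inter> {..<m}. block_weight l i) \<le> (\<Sum>k\<le>n. 2 ^ k * ?d k)"
        by (simp only: prefix lessThan_Suc_atMost)
      have "(2::real) ^ 1 \<le> 2 ^ n"
        using elim by (intro power_increasing) (auto simp: n_def)
      then have den: "(2::real) ^ n / 2 \<le> (\<Sum>i<m. block_weight l i)"
        using sum_block_weight_ge[OF pos, of m] by (simp add: n_def)
      have "?q m \<le> (\<Sum>k\<le>n. 2 ^ k * ?d k) / (2 ^ n / 2)"
        using num den by (intro frac_le) (auto intro!: sum_nonneg)
      then show ?case by (simp add: n_def mult.commute)
    qed
    then have "?q \<longlonglongrightarrow> 0"
      by (intro tendsto_sandwich[OF _ _ tendsto_const lim])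
        (auto intro!: always_eventually divide_nonneg_nonneg sum_nonneg simp: block_weight_nonneg)
    then show "A \<in> erdos_ulam_family (block_weight l)"
      by (simp add: erdos_ulam_family_def)
  }
qed

lemma erdos_ulam_ideal_block_density_ideal:
  assumes pos: "\<forall>n. 0 < l n" and lim: "filterlim l at_top sequentially"
  shows "erdos_ulam_ideal (block_density_ideal l)"
  unfolding erdos_ulam_ideal_def
proof (intro conjI exI allI)
  show "ideal_on_nat (block_density_ideal l)"
    using pos by (rule ideal_on_nat_block_density_ideal)
  show "0 \<le> block_weight l n" for n by (rule block_weight_nonneg)
  show "block_density_ideal l = erdos_ulam_family (block_weight l)"
    using erdos_ulam_family_block_weight[OF pos] by simp
  have "filterlim (\<lambda>n. (2::real) ^ n - 1) at_top sequentially"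
    by (intro filterlim_at_top_mono[OF filterlim_real_sequentially] always_eventually allI)
      (metis add_le_cancel_right diff_add_cancel less_eq_real_def add.commute of_nat_Suc
        of_nat_le_numeral_power_cancel_iff Suc_leI less_exp)
  then have "filterlim (\<lambda>m. (2::real) ^ block_index l m - 1) at_top sequentially"
    by (rule filterlim_compose[OF _ filterlim_block_index[OF pos]])
  then show "filterlim (\<lambda>n. \<Sum>i<n. block_weight l i) at_top sequentially"
    by (rule filterlim_at_top_mono) (simp add: sum_block_weight_ge[OF pos])
  have "filterlim (\<lambda>m. real (l (block_index l m))) at_top sequentially"
    by (intro filterlim_compose[OF filterlim_real_sequentially]
        filterlim_compose[OF lim] filterlim_block_index pos)
  then have inv: "(\<lambda>m. 2 / real (l (block_index l m))) \<longlonglongrightarrow> 0"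
    by (intro tendsto_divide_0[OF tendsto_const] filterlim_at_top_imp_at_infinity)
  have "\<forall>\<^sub>F m in sequentially. 1 \<le> block_index l m"
    using filterlim_block_index[OF pos] by (simp add: filterlim_at_top)
  then have "\<forall>\<^sub>F m in sequentially.
      block_weight l m / (\<Sum>i\<le>m. block_weight l i) \<le> 2 / real (l (block_index l m))"
  proof eventually_elim
    case (elim m)
    define n where "n = block_index l m"
    have "(2::real) ^ 1 \<le> 2 ^ n"
      using elim by (intro power_increasing) (auto simp: n_def)
    moreover have "(\<Sum>i<m. block_weight l i) \<le> (\<Sum>i\<le>m. block_weight l i)"
      by (intro sum_mono2) (auto simp: block_weight_nonneg)
    ultimately have "2 ^ n / 2 \<le> (\<Sum>i\<le>m. block_weight l i)"
      using sum_block_weight_ge[OF pos, of m] by (simp add: n_def)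
    then have "block_weight l m / (\<Sum>i\<le>m. block_weight l i) \<le> (2 ^ n / real (l n)) / (2 ^ n / 2)"
      by (intro frac_le) (auto simp: block_weight_def n_def)
    then show ?case by (simp add: n_def)
  qed
  then show "(\<lambda>n. block_weight l n / (\<Sum>i\<le>n. block_weight l i)) \<longlonglongrightarrow> 0"
    by (intro tendsto_sandwich[OF _ _ tendsto_const inv])
      (auto intro!: always_eventually divide_nonneg_nonneg sum_nonneg simp: block_weight_nonneg)
qed

section \<open>An obstruction for simple density ideals\<close>

text \<open>
  Deleting points of a set or moving them to the right keeps it in a simple density ideal.
\<close>

lemma density_family_shift:
  assumes "\<And>n. 0 \<le> g n" and "B \<in> density_family g"
    and "\<And>n. card (A \<inter> {..<n}) \<le> card (B \<inter> {..<n})"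
  shows "A \<in> density_family g"
proof -
  have lim: "(\<lambda>n. real (card (B \<inter> {..<n})) / g n) \<longlonglongrightarrow> 0"
    using assms(2) by (simp add: density_family_def)
  show ?thesis
    unfolding density_family_def
    using assms(1,3)
    by (auto intro!: tendsto_sandwich[OF _ _ tendsto_const lim] always_eventually divide_right_mono)
qed

text \<open>
  The union of the short, odd-indexed blocks has density \<open>1\<close> in each of them. Its translate into
  the long blocks just before has vanishing densities, because the ratio of the lengths tends to
  \<open>0\<close>. Since the translation moves points to the left, no simple density ideal separates the two
  sets in this way.
\<close>

lemma not_simple_density_ideal_block_density_ideal:
  assumes pos: "\<forall>n. 0 < l n"
    and le: "\<And>m. l (Suc (2 * m)) \<le> l (2 * m)"
    and lim: "(\<lambda>m. real (l (Suc (2 * m))) / real (l (2 * m))) \<longlonglongrightarrow> 0"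
  shows "\<not> simple_density_ideal (block_density_ideal l)"
proof
  assume "simple_density_ideal (block_density_ideal l)"
  then obtain g where g: "\<And>n. 0 \<le> g n" and eq: "block_density_ideal l = density_family g"
    by (auto simp: simple_density_ideal_def)
  define A where "A = {i. odd (block_index l i)}"
  \<comment> \<open>On block \<open>2 m + 1\<close>, \<open>h\<close> is the translation onto an initial segment of block \<open>2 m\<close>.\<close>
  define h where "h i = i - l (block_index l i - 1)" for i
  define B where "B = h ` A"
  have h_block: "h i \<in> block l (2 * m)" and h_end: "h i < block_start l (2 * m) + l (Suc (2 * m))"
    and h_add: "h i + l (2 * m) = i"
    if "block_index l i = Suc (2 * m)" for i m
  proof -
    have "i \<in> block l (Suc (2 * m))"
      using that by (simp add: mem_block_iff[OF pos])
    moreover have "h i = i - l (2 * m)"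
      by (simp add: h_def that)
    ultimately show "h i \<in> block l (2 * m)"
      and "h i < block_start l (2 * m) + l (Suc (2 * m))" and "h i + l (2 * m) = i"
      using le[of m] by (auto simp: block_def block_start_Suc)
  qed
  have inj: "inj_on h A"
  proof (rule inj_onI)
    fix i j
    assume "i \<in> A" "j \<in> A" and hij: "h i = h j"
    then obtain m k where mk: "block_index l i = Suc (2 * m)" "block_index l j = Suc (2 * k)"
      by (auto simp: A_def elim!: oddE)
    have "m = k"
      using h_block[OF mk(1)] h_block[OF mk(2)] hij by (simp add: mem_block_iff[OF pos])
    then show "i = j"
      using h_add[OF mk(1)] h_add[OF mk(2)] hij by metis
  qed
  have "card (A \<inter> {..<n}) \<le> card (B \<inter> {..<n})" for n
  proof (rule card_inj_on_le)
    show "inj_on h (A \<inter> {..<n})"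
      using inj by (rule inj_on_subset) auto
    show "h ` (A \<inter> {..<n}) \<subseteq> B \<inter> {..<n}"
      by (auto simp: B_def h_def)
  qed simp
  moreover have "B \<in> density_family g"
  proof -
    \<comment> \<open>For odd \<open>n\<close> the density of \<open>B\<close> is \<open>0\<close>; rounding the index down to an even number
      gives one bounding sequence for both parities.\<close>
    define u where "u n = real (l (Suc (2 * (n div 2)))) / real (l (2 * (n div 2)))" for n
    have bound: "real (card (B \<inter> block l n)) / real (l n) \<le> u n" for n
    proof (cases "even n")
      case True
      then obtain m where n: "n = 2 * m" by (auto elim: evenE)
      have "B \<inter> block l n \<subseteq> {block_start l n..<block_start l n + l (Suc n)}"
      proof
        fix x assume "x \<in> B \<inter> block l n"
        then obtain i where "i \<in> A" and x: "x = h i" "x \<in> block l n"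
          by (auto simp: B_def)
        then obtain k where k: "block_index l i = Suc (2 * k)"
          by (auto simp: A_def elim!: oddE)
        then have "k = m"
          using h_block[OF k] x n by (simp add: mem_block_iff[OF pos])
        then show "x \<in> {block_start l n..<block_start l n + l (Suc n)}"
          using h_end[OF k] x n by (simp add: block_def)
      qed
      then have "card (B \<inter> block l n) \<le> l (Suc n)"
        using card_mono[of "{block_start l n..<block_start l n + l (Suc n)}" "B \<inter> block l n"] by simp
      then show ?thesis
        using True by (simp add: u_def divide_right_mono)
    next
      case False
      have "x \<notin> block l n" if "x \<in> B" for x
      proof -
        obtain i where "i \<in> A" and x: "x = h i"
          using \<open>x \<in> B\<close> by (auto simp: B_def)
        then obtain k where k: "block_index l i = Suc (2 * k)"
          by (auto simp: A_def elim!: oddE)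
        show ?thesis
          using h_block[OF k] False x by (auto simp: mem_block_iff[OF pos])
      qed
      then have "B \<inter> block l n = {}" by blast
      then show ?thesis by (simp add: u_def)
    qed
    have u: "u \<longlonglongrightarrow> 0"
      unfolding u_def
      by (rule filterlim_compose[OF lim])
        (auto simp: filterlim_at_top eventually_sequentially less_eq_div_iff_mult_less_eq)
    have "(\<lambda>n. real (card (B \<inter> block l n)) / real (l n)) \<longlonglongrightarrow> 0"
      by (rule tendsto_sandwich[OF _ _ tendsto_const u]) (simp_all add: bound)
    then show ?thesis
      using eq by (auto simp: block_density_ideal_def)
  qed
  ultimately have "A \<in> density_family g"
    using density_family_shift g by blast
  then have "(\<lambda>n. real (card (A \<inter> block l n)) / real (l n)) \<longlonglongrightarrow> 0"
    using eq by (auto simp: block_density_ideal_def)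
  then have "(\<lambda>m. real (card (A \<inter> block l (Suc (2 * m)))) / real (l (Suc (2 * m)))) \<longlonglongrightarrow> 0"
    by (rule filterlim_compose[where g = "\<lambda>n. real (card (A \<inter> block l n)) / real (l n)"])
      (auto intro!: filterlim_subseq simp: strict_mono_def)
  moreover have "A \<inter> block l (Suc (2 * m)) = block l (Suc (2 * m))" for m
    by (auto simp: A_def mem_block_iff[OF pos])
  ultimately show False
    using pos by (simp add: less_imp_neq[symmetric] LIMSEQ_const_iff)
qed

section \<open>Rapidly growing block lengths\<close>

text \<open>
  A single factorial grows too slowly for the clean bound \<open>rapid_dominates\<close>: with the square, one
  factor \<open>j\<close> absorbs the number of summands and the other remains as the gain.
\<close>

definition rapid :: "nat \<Rightarrow> nat" where
  "rapid j = fact j * fact j"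

lemma rapid_pos [simp]: "0 < rapid j"
  by (simp add: rapid_def)

lemma rapid_dominates: "j * (\<Sum>i<j. rapid i) \<le> rapid j"
proof (cases j)
  case (Suc m)
  have "(\<Sum>i<Suc m. rapid i) \<le> Suc m * rapid m"
    using sum_bounded_above[of "{..<Suc m}" rapid "rapid m"]
    by (simp add: rapid_def mult_le_mono fact_mono del: sum.lessThan_Suc)
  then have "Suc m * (\<Sum>i<Suc m. rapid i) \<le> Suc m * (Suc m * rapid m)"
    by (rule mult_le_mono2)
  also have "\<dots> = rapid (Suc m)"
    by (simp add: rapid_def algebra_simps)
  finally show ?thesis by (simp add: Suc)
qed simp

lemma mult_rapid_le:
  assumes "i < j"
  shows "j * rapid i \<le> rapid j"
proof -
  have "rapid i \<le> (\<Sum>i<j. rapid i)"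
    using assms by (intro member_le_sum) auto
  then show ?thesis
    using rapid_dominates[of j] by (meson le_trans mult_le_mono2)
qed

lemma filterlim_inj_nat:
  fixes s :: "nat \<Rightarrow> nat"
  assumes "inj s"
  shows "filterlim s at_top sequentially"
  unfolding filterlim_at_top
proof
  fix Z
  have "finite (s -` {..<Z})"
    using assms by (intro finite_vimageI) auto
  then show "\<forall>\<^sub>F n in sequentially. Z \<le> s n"
    unfolding cofinite_eq_sequentially[symmetric] eventually_cofinite
    by (simp add: vimage_def not_le)
qed

lemma inverse_inj_tendsto_0:
  fixes s :: "nat \<Rightarrow> nat"
  assumes "inj s"
  shows "(\<lambda>n. 1 / real (s n)) \<longlonglongrightarrow> 0"
  by (intro tendsto_divide_0[OF tendsto_const] filterlim_at_top_imp_at_infinity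
      filterlim_compose[OF filterlim_real_sequentially] filterlim_inj_nat assms)

definition rapid_ideal :: "(nat \<Rightarrow> nat) \<Rightarrow> nat set set" where
  "rapid_ideal s = block_density_ideal (\<lambda>n. rapid (s n))"

lemma erdos_ulam_rapid_ideal:
  assumes "inj s"
  shows "erdos_ulam_ideal (rapid_ideal s)"
proof -
  have "n \<le> rapid n" for n
    using fact_ge_self[of n] by (simp add: rapid_def le_trans)
  then have "filterlim rapid at_top sequentially"
    by (intro filterlim_at_top_mono[OF filterlim_ident] always_eventually) simp
  then show ?thesis
    unfolding rapid_ideal_def
    by (intro erdos_ulam_ideal_block_density_ideal
        filterlim_compose[OF _ filterlim_inj_nat[OF assms]]) simp_all
qed

lemma finite_union_small_blocks:
  fixes s :: "nat \<Rightarrow> nat"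
  assumes "inj s"
  shows "finite (\<Union>n\<in>{n. s n < j}. block l n)"
proof -
  have "finite (s -` {..<j})"
    using assms by (intro finite_vimageI) auto
  then show ?thesis by (simp add: vimage_def)
qed

lemma card_union_small_blocks:
  assumes "inj s"
  shows "j * card (\<Union>n\<in>{n. s n < j}. block (\<lambda>n. rapid (s n)) n) \<le> rapid j"
proof -
  have fin: "finite {n. s n < j}"
    using finite_vimageI[OF _ assms, of "{..<j}"] by (simp add: vimage_def)
  have "card (\<Union>n\<in>{n. s n < j}. block (\<lambda>n. rapid (s n)) n) \<le> (\<Sum>n\<in>{n. s n < j}. rapid (s n))"
    using card_UN_le[OF fin, of "block (\<lambda>n. rapid (s n))"] by simp
  also have "\<dots> = (\<Sum>i\<in>s ` {n. s n < j}. rapid i)"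
    using assms by (simp add: sum.reindex inj_on_subset)
  also have "\<dots> \<le> (\<Sum>i<j. rapid i)"
    by (rule sum_mono2) auto
  finally show ?thesis
    using rapid_dominates[of j] by (meson le_trans mult_le_mono2)
qed

text \<open>
  If infinitely many lengths are missing on the side of \<open>s\<close>, collect the parts of the corresponding
  blocks that \<open>\<phi>\<close> sends into longer blocks. The images are sparse there, although almost nothing
  of the original blocks is left out.
\<close>

lemma ideal_below_rapid_ideal:
  assumes "inj s" "inj t" and below: "ideal_below (rapid_ideal s) (rapid_ideal t)"
  shows "finite {n. t n \<notin> range s}"
proof (rule ccontr)
  assume inf: "infinite {n. t n \<notin> range s}"
  define l where "l = (\<lambda>n. rapid (s n))"
  define l' where "l' = (\<lambda>n. rapid (t n))"
  have pos: "\<forall>n. 0 < l n" and pos': "\<forall>n. 0 < l' n"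
    by (simp_all add: l_def l'_def)
  obtain \<phi> :: "nat \<Rightarrow> nat" where "bij \<phi>"
    and \<phi>: "\<And>A. A \<in> rapid_ideal s \<Longrightarrow> \<phi> -` A \<in> rapid_ideal t"
    using below by (auto simp: ideal_below_def)
  \<comment> \<open>The points of blocks whose length is unavailable on the side of \<open>s\<close>
    that are sent to a longer block.\<close>
  define C where "C = {x. t (block_index l' x) \<notin> range s
    \<and> t (block_index l' x) < s (block_index l (\<phi> x))}"
  have "\<phi> ` C \<in> rapid_ideal s"
  proof -
    have "real (card (\<phi> ` C \<inter> block l m)) / real (l m) \<le> 1 / real (s m)"
      if "1 \<le> s m" for m
    proof -
      let ?U = "\<Union>n\<in>{n. t n < s m}. block l' n"
      have "\<phi> ` C \<inter> block l m \<subseteq> \<phi> ` ?U"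
        by (auto simp: C_def mem_block_iff[OF pos] mem_block_iff[OF pos'])
      then have "card (\<phi> ` C \<inter> block l m) \<le> card (\<phi> ` ?U)"
        by (intro card_mono finite_imageI finite_union_small_blocks assms)
      also have "\<dots> \<le> card ?U"
        by (intro card_image_le finite_union_small_blocks assms)
      finally have "s m * card (\<phi> ` C \<inter> block l m) \<le> l m"
        using card_union_small_blocks[OF assms(2), of "s m"]
        unfolding l_def l'_def by (meson le_trans mult_le_mono2)
      then have "real (s m) * real (card (\<phi> ` C \<inter> block l m)) \<le> real (l m)"
        by (simp flip: of_nat_mult)
      then show ?thesis
        using that pos by (simp add: field_simps)
    qed
    moreover have "\<forall>\<^sub>F m in sequentially. 1 \<le> s m"
      using filterlim_inj_nat[OF assms(1)] unfolding filterlim_at_top by (rule spec)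
    ultimately have "\<forall>\<^sub>F m in sequentially.
        real (card (\<phi> ` C \<inter> block l m)) / real (l m) \<le> 1 / real (s m)"
      by (auto elim: eventually_mono)
    then have "(\<lambda>m. real (card (\<phi> ` C \<inter> block l m)) / real (l m)) \<longlonglongrightarrow> 0"
      by (intro tendsto_sandwich[OF _ _ tendsto_const inverse_inj_tendsto_0[OF assms(1)]]) simp_all
    then show ?thesis
      by (simp add: rapid_ideal_def block_density_ideal_def l_def)
  qed
  then have "\<phi> -` (\<phi> ` C) \<in> rapid_ideal t"
    by (rule \<phi>)
  moreover have "\<phi> -` (\<phi> ` C) = C"
    using \<open>bij \<phi>\<close> by (simp add: bij_is_inj inj_vimage_image_eq)
  ultimately have "(\<lambda>n. real (card (C \<inter> block l' n)) / real (l' n)) \<longlonglongrightarrow> 0"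
    by (simp add: rapid_ideal_def block_density_ideal_def l'_def)
  then have "\<forall>\<^sub>F n in sequentially. real (card (C \<inter> block l' n)) / real (l' n) < 1 / 2"
    by (rule order_tendstoD) simp
  moreover have "\<forall>\<^sub>F n in sequentially. 2 \<le> t n"
    using filterlim_inj_nat[OF assms(2)] by (simp add: filterlim_at_top)
  ultimately have ev: "\<forall>\<^sub>F n in sequentially.
      real (card (C \<inter> block l' n)) / real (l' n) < 1 / 2 \<and> 2 \<le> t n"
    by (rule eventually_conj)
  have "\<exists>\<^sub>F n in sequentially. t n \<notin> range s"
    using inf by (simp add: frequently_def cofinite_eq_sequentially[symmetric] eventually_cofinite)
  then obtain n where n: "t n \<notin> range s" "2 \<le> t n"
    and small: "real (card (C \<inter> block l' n)) / real (l' n) < 1 / 2"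
    using frequently_ex[OF frequently_eventually_frequently[OF _ ev]] by blast
  \<comment> \<open>Equal lengths are excluded by \<open>t n \<notin> range s\<close>, so what is left of block \<open>n\<close> outside \<open>C\<close>
    is sent to strictly shorter blocks, which fill at most half of its length as \<open>t n \<ge> 2\<close>.\<close>
  let ?V = "\<Union>m\<in>{m. s m < t n}. block l m"
  have "inj_on \<phi> (block l' n - C)"
    using \<open>bij \<phi>\<close> bij_is_inj inj_on_subset by blast
  moreover have "\<phi> ` (block l' n - C) \<subseteq> ?V"
  proof
    fix y assume "y \<in> \<phi> ` (block l' n - C)"
    then obtain x where "y = \<phi> x" "block_index l' x = n" "x \<notin> C"
      by (auto simp: mem_block_iff[OF pos'])
    then have "s (block_index l y) \<le> t n"
      using n by (simp add: C_def)
    then have "s (block_index l y) < t n"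
      using n by (metis le_neq_implies_less rangeI)
    then show "y \<in> ?V"
      by (auto simp: mem_block_iff[OF pos])
  qed
  ultimately have "card (block l' n - C) \<le> card ?V"
    by (intro card_inj_on_le[of \<phi>] finite_union_small_blocks assms)
  then have "2 * card (block l' n - C) \<le> t n * card ?V"
    using n(2) by (rule mult_le_mono[rotated])
  also have "\<dots> \<le> l' n"
    using card_union_small_blocks[OF assms(1), of "t n"] by (simp add: l_def l'_def)
  finally have "2 * card (block l' n - C) \<le> l' n" .
  moreover have "card (block l' n - C) + card (C \<inter> block l' n) = l' n"
    using card_Int_Diff[of "block l' n" C] by (simp add: Int_commute)
  ultimately have "l' n \<le> 2 * card (C \<inter> block l' n)" by simp
  then have "real (l' n) \<le> 2 * real (card (C \<inter> block l' n))"
    by linarith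
  then show False
    using small pos' by (simp add: field_simps)
qed

section \<open>Continuum many block orders\<close>

definition swap_pairs :: "nat \<Rightarrow> nat" where
  "swap_pairs n = (if even n then Suc n else n - 1)"

text \<open>
  The swap in the quotient by \<open>2\<close> puts the larger length first in every pair of neighbouring
  blocks and makes the value determine the index. The remainder records whether a number \<open>p\<close> is
  in \<open>X\<close>, where every \<open>p\<close> is asked for at infinitely many indices; so a difference of two sets at
  a single point produces infinitely many lengths that only one of them uses.
\<close>

definition coded_order :: "nat set \<Rightarrow> nat \<Rightarrow> nat" where
  "coded_order X n = 2 * swap_pairs n + of_bool (fst (prod_decode (n div 2)) \<in> X)"

lemma swap_pairs_swap_pairs [simp]: "swap_pairs (swap_pairs n) = n"
  by (auto simp: swap_pairs_def elim!: oddE)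

lemma coded_order_div_2 [simp]: "coded_order X n div 2 = swap_pairs n"
  by (simp add: coded_order_def)

lemma coded_order_eq_imp_eq:
  assumes "coded_order X m = coded_order Y n"
  shows "m = n"
  using assms coded_order_div_2 swap_pairs_swap_pairs by metis

lemma inj_coded_order: "inj (coded_order X)"
  using coded_order_eq_imp_eq by (blast intro: injI)

lemma infinite_coded_order_diff:
  assumes "X \<noteq> Y"
  shows "infinite {n. coded_order Y n \<notin> range (coded_order X)}"
proof -
  obtain p where p: "p \<in> X \<longleftrightarrow> p \<notin> Y"
    using assms by (auto simp: set_eq_iff)
  have "coded_order Y (2 * prod_encode (p, k)) \<notin> range (coded_order X)" for k
  proof
    assume "coded_order Y (2 * prod_encode (p, k)) \<in> range (coded_order X)"
    then obtain m where eq: "coded_order X m = coded_order Y (2 * prod_encode (p, k))"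
      by auto
    then have "m = 2 * prod_encode (p, k)"
      by (rule coded_order_eq_imp_eq)
    then show False
      using eq p by (auto simp: coded_order_def)
  qed
  then have "range (\<lambda>k. 2 * prod_encode (p, k)) \<subseteq> {n. coded_order Y n \<notin> range (coded_order X)}"
    by blast
  moreover have "infinite (range (\<lambda>k. 2 * prod_encode (p, k)))"
    by (rule range_inj_infinite) (auto intro!: injI)
  ultimately show ?thesis
    using finite_subset by blast
qed

lemma not_simple_density_coded_order:
  "\<not> simple_density_ideal (rapid_ideal (coded_order X))"
  unfolding rapid_ideal_def
proof (rule not_simple_density_ideal_block_density_ideal)
  let ?l = "\<lambda>n. rapid (coded_order X n)"
  have less: "coded_order X (Suc (2 * m)) < coded_order X (2 * m)" for m
    by (simp add: coded_order_def swap_pairs_def)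
  have mult_le: "coded_order X (2 * m) * ?l (Suc (2 * m)) \<le> ?l (2 * m)" for m
    by (rule mult_rapid_le[OF less])
  show "\<forall>n. 0 < ?l n" by simp
  have pos: "0 < coded_order X (2 * m)" for m
    using less[of m] by simp
  show "?l (Suc (2 * m)) \<le> ?l (2 * m)" for m
    using mult_le_mono1[of 1 "coded_order X (2 * m)" "?l (Suc (2 * m))"] mult_le[of m] pos[of m]
    by linarith
  have bound: "real (?l (Suc (2 * m))) / real (?l (2 * m)) \<le> 1 / real (coded_order X (2 * m))" for m
  proof -
    have "real (coded_order X (2 * m)) * real (?l (Suc (2 * m))) \<le> real (?l (2 * m))"
      using mult_le[of m] by (simp flip: of_nat_mult)
    then show ?thesis
      using pos[of m] by (simp add: field_simps)
  qed
  have "inj (\<lambda>m. coded_order X (2 * m))"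
    by (auto intro!: injI dest!: coded_order_eq_imp_eq)
  then have inv: "(\<lambda>m. 1 / real (coded_order X (2 * m))) \<longlonglongrightarrow> 0"
    by (rule inverse_inj_tendsto_0)
  show "(\<lambda>m. real (?l (Suc (2 * m))) / real (?l (2 * m))) \<longlonglongrightarrow> 0"
    by (rule tendsto_sandwich[OF _ _ tendsto_const inv]) (simp_all add: bound)
qed

lemma not_ideal_below_coded_order:
  assumes "X \<noteq> Y"
  shows "\<not> ideal_below (rapid_ideal (coded_order X)) (rapid_ideal (coded_order Y))"
  using ideal_below_rapid_ideal[OF inj_coded_order inj_coded_order]
    infinite_coded_order_diff[OF assms] by blast

lemma ideal_below_refl: "ideal_below I I"
  unfolding ideal_below_def by (rule exI[of _ id]) simp

theorem proposition5:
  shows "\<exists>F :: nat set set set.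
    ideal_antichain F \<and>
    F \<approx> (UNIV :: real set) \<and>
    (\<forall>I\<in>F. erdos_ulam_ideal I \<and> \<not> simple_density_ideal I)"
proof (intro exI conjI)
  define \<I> where "\<I> X = rapid_ideal (coded_order X)" for X
  have eu: "erdos_ulam_ideal (\<I> X)" for X
    unfolding \<I>_def by (rule erdos_ulam_rapid_ideal[OF inj_coded_order])
  have below: "\<not> ideal_below (\<I> X) (\<I> Y)" if "X \<noteq> Y" for X Y
    unfolding \<I>_def by (rule not_ideal_below_coded_order[OF that])
  show "ideal_antichain (range \<I>)"
    unfolding ideal_antichain_def
  proof (intro conjI ballI impI)
    fix I assume "I \<in> range \<I>"
    then show "ideal_on_nat I"
      using eu by (auto simp: erdos_ulam_ideal_def)
  next
    fix I J assume "I \<in> range \<I>" "J \<in> range \<I>" "I \<noteq> J"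
    then show "\<not> ideal_below I J" "\<not> ideal_below J I"
      using below by (metis rangeE)+
  qed
  have "inj \<I>"
    using below ideal_below_refl by (metis injI)
  then have "(UNIV :: nat set set) \<approx> range \<I>"
    using bij_betw_imageI eqpoll_def by blast
  then show "range \<I> \<approx> (UNIV :: real set)"
    using eqpoll_sym eqpoll_trans nat_sets_eqpoll_reals by blast
  show "\<forall>I\<in>range \<I>. erdos_ulam_ideal I \<and> \<not> simple_density_ideal I"
    using eu not_simple_density_coded_order by (auto simp: \<I>_def)
qed

end
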